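(* Let $C_0,C_1,C_2,C_3>0$ with $C_3\le C_0$ and $C_3<C_1+C_2$, let $\beta,\xi\in[0,1]$, and define the stationary flow-rate $$q=\begin{cases} C_2/(1-\xi), & 0\le \xi\le 1-\frac{C_2}{C_3},\\ C_3, & 1-\frac{C_2}{C_3}<\xi<\frac{C_1}{C_3},\\ C_1/\xi, & \frac{C_1}{C_3}\le\xi\le 1.\end{cases}$$ (a) If $\xi\in\Xi_1$, the fixed point of the Poincaré map $F$ (its branch for $\Xi_1$) is $v^*=\xi q$; namely $$v^*=\begin{cases} C_1, & \frac{C_1}{C_3}\le\xi\le1,\\ \xi C_3, & \xi\in\left(1-\frac{C_2}{C_3},\frac{C_1}{C_3}\right)\text{ and }\xi\ge\beta.\end{cases}$$ (b) If $\xi\in\Xi_2$, the fixed point of the Poincaré map $F$ (its branch for $\Xi_2$) is $v^*=C_3-(1-\xi)q$; namely $$v^*=\begin{cases} C_3-C_2, & 0\le\xi\le 1-\frac{C_2}{C_3},\\ \xi C_3, & \xi\in\left(1-\frac{C_2}{C_3},\frac{C_1}{C_3}\right)\text{ and }\xi\le\beta.\end{cases}$$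
   Context: The setting is a diverge-merge (DM) traffic network: upstream link 0, two parallel intermediate links 1 and 2, and downstream link 3. $C_a>0$ is the capacity of link $a$; $\beta$ is the merging ratio of link 1; $\xi$ is the constant proportion of vehicles choosing link 1; $q$ is the total flow-rate of the network in its stationary states (so that the stationary flow-rates on links 1 and 2 are $\xi q$ and $(1-\xi)q$). For $C_3\le C_0$ and $C_3<C_1+C_2$, let $\Xi_1$ be the set of $\xi\in[0,1]$ such that either $\frac{C_1}{C_3}\le\xi\le1$, or $1-\frac{C_2}{C_3}<\xi<\frac{C_1}{C_3}$ and $\xi\ge\beta$. Let $\Xi_2$ be the set of $\xi\in[0,1]$ such that either $0\le\xi\le1-\frac{C_2}{C_3}$, or $1-\frac{C_2}{C_3}<\xi<\frac{C_1}{C_3}$ and $\xi\le\beta$. It is assumed that $\xi>0$ when $\xi\in\Xi_1$ is considered and $\xi<1$ when $\xi\in\Xi_2$ is considered, so that the formulas below make sense. Put $$A_1=\max\{C_3-(1-\xi)C_0,\;C_3-C_2,\;\beta C_3\},\qquad A_2'=\min\{\xi C_0,\;C_1,\;\beta C_3\}.$$ The Poincaré map $F$ is the one-dimensional map $$Fv=\begin{cases}\min\{C_1,\max\{A_1,\,C_3-\frac{1-\xi}{\xi}v\}\}, & \xi\in\Xi_1,\\ \max\{C_3-C_2,\min\{A_2',\,\frac{\xi}{1-\xi}(C_3-v)\}\}, & \xi\in\Xi_2.\end{cases}$$ In the branch $\xi\in\Xi_1$, $v$ is the out-flux of link 1, so $v\in[0,C_1]$; in the branch $\xi\in\Xi_2$,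 $C_3-v$ is the out-flux of link 2, so $v\in[C_3-C_2,C_3]$. If $\xi$ lies in both $\Xi_1$ and $\Xi_2$, each part of the claim refers to its own branch. *)

theory Defs
  imports Complex_Main
begin

text \<open>
  Diverge-merge network with upstream link 0, parallel links 1 and 2, downstream link 3;
  \<open>C0, \<dots>, C3\<close> are the link capacities, \<open>\<beta>\<close> is the merging ratio of link 1 and \<open>\<xi>\<close> the
  proportion of vehicles choosing link 1.
\<close>

definition Xi1 :: "real \<Rightarrow> real \<Rightarrow> real \<Rightarrow> real \<Rightarrow> real set" where
  "Xi1 C1 C2 C3 \<beta> = {\<xi> \<in> {0..1}.
     (C1 / C3 \<le> \<xi> \<and> \<xi> \<le> 1) \<or>
     (1 - C2 / C3 < \<xi> \<and> \<xi> < C1 / C3 \<and> \<xi> \<ge> \<beta>)}"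

definition Xi2 :: "real \<Rightarrow> real \<Rightarrow> real \<Rightarrow> real \<Rightarrow> real set" where
  "Xi2 C1 C2 C3 \<beta> = {\<xi> \<in> {0..1}.
     (0 \<le> \<xi> \<and> \<xi> \<le> 1 - C2 / C3) \<or>
     (1 - C2 / C3 < \<xi> \<and> \<xi> < C1 / C3 \<and> \<xi> \<le> \<beta>)}"

text \<open>
  For \<open>0 \<le> \<xi> \<le> 1\<close>, \<open>0 < C3\<close> and \<open>C3 < C1 + C2\<close> the three ranges of \<open>\<xi>\<close> below are disjoint
  and the last branch is exactly \<open>C1 / C3 \<le> \<xi> \<le> 1\<close>.
\<close>

definition stationary_flow :: "real \<Rightarrow> real \<Rightarrow> real \<Rightarrow> real \<Rightarrow> real" where
  "stationary_flow C1 C2 C3 \<xi> =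
     (if \<xi> \<le> 1 - C2 / C3 then C2 / (1 - \<xi>)
      else if \<xi> < C1 / C3 then C3
      else C1 / \<xi>)"

definition A1 :: "real \<Rightarrow> real \<Rightarrow> real \<Rightarrow> real \<Rightarrow> real \<Rightarrow> real" where
  "A1 C0 C2 C3 \<beta> \<xi> = max (C3 - (1 - \<xi>) * C0) (max (C3 - C2) (\<beta> * C3))"

definition A2' :: "real \<Rightarrow> real \<Rightarrow> real \<Rightarrow> real \<Rightarrow> real \<Rightarrow> real" where
  "A2' C0 C1 C3 \<beta> \<xi> = min (\<xi> * C0) (min C1 (\<beta> * C3))"

text \<open>
  \<open>Xi1\<close> and \<open>Xi2\<close> overlap when \<open>\<xi> = \<beta>\<close>, so the two branches of the Poincare map are
  separate functions. The first acts on the out-flux \<open>v\<close> of link 1, with domain \<open>{0..C1}\<close>,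
  and is meant for \<open>\<xi> > 0\<close>; in the second \<open>C3 - v\<close> is the out-flux of link 2, the domain is
  \<open>{C3 - C2..C3}\<close>, and \<open>\<xi> < 1\<close>.
\<close>

definition poincare1 :: "real \<Rightarrow> real \<Rightarrow> real \<Rightarrow> real \<Rightarrow> real \<Rightarrow> real \<Rightarrow> real \<Rightarrow> real" where
  "poincare1 C0 C1 C2 C3 \<beta> \<xi> v =
     min C1 (max (A1 C0 C2 C3 \<beta> \<xi>) (C3 - (1 - \<xi>) / \<xi> * v))"

definition poincare2 :: "real \<Rightarrow> real \<Rightarrow> real \<Rightarrow> real \<Rightarrow> real \<Rightarrow> real \<Rightarrow> real \<Rightarrow> real" where
  "poincare2 C0 C1 C2 C3 \<beta> \<xi> v =
     max (C3 - C2) (min (A2' C0 C1 C3 \<beta> \<xi>) (\<xi> / (1 - \<xi>) * (C3 - v)))"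

end

theory Submission
  imports Defs
begin

text \<open>
  Both branches of the Poincare map are nonincreasing in \<open>v\<close>, so each has at most one
  fixed point, and it is enough to check that the claimed value is one. For \<open>\<xi>\<close> in the
  middle range, \<open>C3 \<le> C0\<close> and \<open>\<beta> \<le> \<xi>\<close> (resp. \<open>\<xi> \<le> \<beta>\<close>) ensure that \<open>A1\<close> (resp. \<open>A2'\<close>)
  does not cut off the linear part at \<open>v = \<xi> * C3\<close>.
\<close>

text \<open>If \<open>v\<close> is another fixed point and \<open>v \<le> a\<close>, then
  \<open>a = f a \<le> f v = v\<close>; the case \<open>a \<le> v\<close> is symmetric. Uniqueness
  thus holds on the whole order, and \<open>S\<close> only has to contain \<open>a\<close>.\<close>

lemma antimono_fixed_points:
  fixes f :: "'a::linorder \<Rightarrow> 'a"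
  assumes "antimono f" and "a \<in> S" and "f a = a"
  shows "{v \<in> S. f v = v} = {a}"
proof -
  have "v = a" if "f v = v" for v
    using assms that by (metis antimonoD linear order.antisym)
  with assms(2,3) show ?thesis
    by blast
qed

lemma antimono_poincare1:
  assumes "0 < \<xi>" and "\<xi> \<le> 1"
  shows "antimono (poincare1 C0 C1 C2 C3 \<beta> \<xi>)"
proof (rule antimonoI)
  fix u v :: real
  assume "u \<le> v"
  then have "(1 - \<xi>) / \<xi> * u \<le> (1 - \<xi>) / \<xi> * v"
    using assms by (intro mult_left_mono) auto
  then show "poincare1 C0 C1 C2 C3 \<beta> \<xi> v \<le> poincare1 C0 C1 C2 C3 \<beta> \<xi> u"
    unfolding poincare1_def by (intro min.mono max.mono) auto
qed

lemma antimono_poincare2: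
  assumes "0 \<le> \<xi>" and "\<xi> < 1"
  shows "antimono (poincare2 C0 C1 C2 C3 \<beta> \<xi>)"
proof (rule antimonoI)
  fix u v :: real
  assume "u \<le> v"
  then have "\<xi> / (1 - \<xi>) * (C3 - v) \<le> \<xi> / (1 - \<xi>) * (C3 - u)"
    using assms by (intro mult_left_mono) auto
  then show "poincare2 C0 C1 C2 C3 \<beta> \<xi> v \<le> poincare2 C0 C1 C2 C3 \<beta> \<xi> u"
    unfolding poincare2_def by (intro min.mono max.mono) auto
qed

text \<open>After clearing \<open>\<xi>\<close>, the second hypothesis says that the linear part is
  at least \<open>C1\<close> at \<open>v = C1\<close>. The outer \<open>min\<close> then returns
  \<open>C1\<close>, whatever the value of \<open>A1\<close>.\<close>

lemma poincare1_C1: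
  assumes "0 < \<xi>" and "C1 \<le> \<xi> * C3"
  shows "poincare1 C0 C1 C2 C3 \<beta> \<xi> C1 = C1"
proof -
  have "C1 \<le> C3 - (1 - \<xi>) / \<xi> * C1"
    using assms by (simp add: field_simps)
  then show ?thesis
    by (simp add: poincare1_def)
qed

text \<open>Mirror image, with link 2 at capacity: at \<open>C3 - v = C2\<close> the linear part is
  at most \<open>C3 - C2\<close>, so the outer \<open>max\<close> decides for every value of
  \<open>A2'\<close>.\<close>

lemma poincare2_C3_minus_C2:
  assumes "\<xi> < 1" and "\<xi> * C3 \<le> C3 - C2"
  shows "poincare2 C0 C1 C2 C3 \<beta> \<xi> (C3 - C2) = C3 - C2"
proof -
  have "\<xi> / (1 - \<xi>) * C2 \<le> C3 - C2"
    using assms by (simp add: field_simps)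
  then show ?thesis
    by (simp add: poincare2_def)
qed

lemma poincare1_xi_C3:
  assumes "0 < \<xi>" and "\<xi> \<le> 1" and "0 \<le> C3" and "C3 \<le> C0" and "\<beta> \<le> \<xi>"
    and "C3 - C2 \<le> \<xi> * C3" and "\<xi> * C3 \<le> C1"
  shows "poincare1 C0 C1 C2 C3 \<beta> \<xi> (\<xi> * C3) = \<xi> * C3"
proof -
  \<comment> \<open>These bound the first and third terms of \<open>A1\<close> by
    \<open>\<xi> * C3\<close>; the bound on \<open>C3 - C2\<close> is a hypothesis.\<close>
  have "(1 - \<xi>) * C3 \<le> (1 - \<xi>) * C0" and "\<beta> * C3 \<le> \<xi> * C3"
    using assms by (auto intro: mult_left_mono mult_right_mono)
  then have "A1 C0 C2 C3 \<beta> \<xi> \<le> \<xi> * C3"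
    using assms by (auto simp: A1_def algebra_simps)
  moreover have "(1 - \<xi>) / \<xi> * (\<xi> * C3) = (1 - \<xi>) * C3"
    using assms by simp
  then have "C3 - (1 - \<xi>) / \<xi> * (\<xi> * C3) = \<xi> * C3"
    by (simp add: left_diff_distrib)
  ultimately show ?thesis
    using assms by (simp add: poincare1_def max_absorb2 min_absorb2)
qed

lemma poincare2_xi_C3:
  assumes "0 \<le> \<xi>" and "\<xi> < 1" and "0 \<le> C3" and "C3 \<le> C0" and "\<xi> \<le> \<beta>"
    and "C3 - C2 \<le> \<xi> * C3" and "\<xi> * C3 \<le> C1"
  shows "poincare2 C0 C1 C2 C3 \<beta> \<xi> (\<xi> * C3) = \<xi> * C3"
proof -
  have "\<xi> * C3 \<le> \<xi> * C0" and "\<xi> * C3 \<le> \<beta> * C3"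
    using assms by (auto intro: mult_left_mono mult_right_mono)
  then have "\<xi> * C3 \<le> A2' C0 C1 C3 \<beta> \<xi>"
    using assms by (auto simp: A2'_def)
  moreover have "\<xi> / (1 - \<xi>) * (C3 - \<xi> * C3) = \<xi> * C3"
    using assms by (simp add: field_simps)
  ultimately show ?thesis
    using assms by (simp add: poincare2_def max_absorb2 min_absorb2)
qed

theorem theorem3p1:
  fixes C0 C1 C2 C3 \<beta> \<xi> q :: real
  assumes "C0 > 0" and "C1 > 0" and "C2 > 0" and "C3 > 0"
    and "C3 \<le> C0" and "C3 < C1 + C2"
    and "\<beta> \<in> {0..1}" and "\<xi> \<in> {0..1}"
    and "q = stationary_flow C1 C2 C3 \<xi>"
  shows "(\<xi> \<in> Xi1 C1 C2 C3 \<beta> \<and> \<xi> > 0 \<longrightarrow>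
            {v \<in> {0..C1}. poincare1 C0 C1 C2 C3 \<beta> \<xi> v = v} = {\<xi> * q} \<and>
            (C1 / C3 \<le> \<xi> \<and> \<xi> \<le> 1 \<longrightarrow> \<xi> * q = C1) \<and>
            (1 - C2 / C3 < \<xi> \<and> \<xi> < C1 / C3 \<and> \<xi> \<ge> \<beta> \<longrightarrow> \<xi> * q = \<xi> * C3))
       \<and> (\<xi> \<in> Xi2 C1 C2 C3 \<beta> \<and> \<xi> < 1 \<longrightarrow>
            {v \<in> {C3 - C2..C3}. poincare2 C0 C1 C2 C3 \<beta> \<xi> v = v} = {C3 - (1 - \<xi>) * q} \<and>
            (0 \<le> \<xi> \<and> \<xi> \<le> 1 - C2 / C3 \<longrightarrow> C3 - (1 - \<xi>) * q = C3 - C2) \<and>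
            (1 - C2 / C3 < \<xi> \<and> \<xi> < C1 / C3 \<and> \<xi> \<le> \<beta> \<longrightarrow> C3 - (1 - \<xi>) * q = \<xi> * C3))"
proof -
  have \<xi>: "0 \<le> \<xi>" "\<xi> \<le> 1"
    using assms by auto
  \<comment> \<open>Multiplying the thresholds by \<open>C3\<close> turns every case distinction
    into a comparison of \<open>\<xi> * C3\<close> with \<open>C3 - C2\<close> or \<open>C1\<close>,
    the form used by the fixed-point lemmas.\<close>
  have low_iff: "\<xi> \<le> 1 - C2 / C3 \<longleftrightarrow> \<xi> * C3 \<le> C3 - C2"
    "1 - C2 / C3 < \<xi> \<longleftrightarrow> C3 - C2 < \<xi> * C3"
    using \<open>C3 > 0\<close> by (simp_all add: field_simps)
  have high_iff: "C1 / C3 \<le> \<xi> \<longleftrightarrow> C1 \<le> \<xi> * C3"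
    "\<xi> < C1 / C3 \<longleftrightarrow> \<xi> * C3 < C1"
    using \<open>C3 > 0\<close> by (simp_all add: field_simps)
  have q: "q = (if \<xi> * C3 \<le> C3 - C2 then C2 / (1 - \<xi>) else if \<xi> * C3 < C1 then C3 else C1 / \<xi>)"
    using assms(9) by (simp add: stationary_flow_def low_iff high_iff)
  have "\<xi> * C3 \<ge> 0" "\<xi> * C3 \<le> C3"
    using \<xi> \<open>C3 > 0\<close> by (simp_all add: mult_left_le_one_le)
  \<comment> \<open>Here \<open>C3 - C2 < C1 \<le> \<xi> * C3\<close> excludes the first branch of
    \<open>q\<close>.\<close>
  have high: "\<xi> * q = C1" if "C1 \<le> \<xi> * C3" "0 < \<xi>"
    using that \<open>C3 < C1 + C2\<close> by (simp add: q)
  have mid: "q = C3" if "C3 - C2 < \<xi> * C3" "\<xi> * C3 < C1"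
    using that by (simp add: q)
  have low: "(1 - \<xi>) * q = C2" if "\<xi> * C3 \<le> C3 - C2" "\<xi> < 1"
    using that by (simp add: q)
  have a: "{v \<in> {0..C1}. poincare1 C0 C1 C2 C3 \<beta> \<xi> v = v} = {\<xi> * q}"
    if "\<xi> \<in> Xi1 C1 C2 C3 \<beta>" "0 < \<xi>"
  proof (rule antimono_fixed_points[OF antimono_poincare1])
    from that(1) consider "C1 \<le> \<xi> * C3" | "C3 - C2 < \<xi> * C3" "\<xi> * C3 < C1" "\<beta> \<le> \<xi>"
      by (auto simp: Xi1_def high_iff low_iff)
    then have "\<xi> * q \<in> {0..C1} \<and> poincare1 C0 C1 C2 C3 \<beta> \<xi> (\<xi> * q) = \<xi> * q"
    proof cases
      case 1
      then show ?thesis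
        using high poincare1_C1 \<open>0 < \<xi>\<close> \<open>C1 > 0\<close> by simp
    next
      case 2
      then show ?thesis
        using mid poincare1_xi_C3 \<xi> \<open>0 < \<xi>\<close> \<open>\<xi> * C3 \<ge> 0\<close> assms by simp
    qed
    then show "\<xi> * q \<in> {0..C1}" "poincare1 C0 C1 C2 C3 \<beta> \<xi> (\<xi> * q) = \<xi> * q"
      by auto
  qed (use \<xi> that in auto)
  have b: "{v \<in> {C3 - C2..C3}. poincare2 C0 C1 C2 C3 \<beta> \<xi> v = v} = {C3 - (1 - \<xi>) * q}"
    if "\<xi> \<in> Xi2 C1 C2 C3 \<beta>" "\<xi> < 1"
  proof (rule antimono_fixed_points[OF antimono_poincare2])
    from that(1) consider "\<xi> * C3 \<le> C3 - C2" | "C3 - C2 < \<xi> * C3" "\<xi> * C3 < C1" "\<xi> \<le> \<beta>"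
      by (auto simp: Xi2_def high_iff low_iff)
    then have "C3 - (1 - \<xi>) * q \<in> {C3 - C2..C3} \<and>
      poincare2 C0 C1 C2 C3 \<beta> \<xi> (C3 - (1 - \<xi>) * q) = C3 - (1 - \<xi>) * q"
    proof cases
      case 1
      then show ?thesis
        using low poincare2_C3_minus_C2 \<open>\<xi> < 1\<close> \<open>C2 > 0\<close> by simp
    next
      case 2
      \<comment> \<open>With \<open>q = C3\<close>, the out-flux of link 2 is
        \<open>(1 - \<xi>) * C3\<close>, which leaves \<open>\<xi> * C3\<close> for link 1, the same
        value as in the other branch.\<close>
      then have "C3 - (1 - \<xi>) * q = \<xi> * C3"
        using mid by (simp add: algebra_simps)
      with 2 show ?thesis
        using poincare2_xi_C3 \<xi> \<open>\<xi> < 1\<close> \<open>\<xi> * C3 \<le> C3\<close> assms by simp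
    qed
    then show "C3 - (1 - \<xi>) * q \<in> {C3 - C2..C3}"
      "poincare2 C0 C1 C2 C3 \<beta> \<xi> (C3 - (1 - \<xi>) * q) = C3 - (1 - \<xi>) * q"
      by auto
  qed (use \<xi> that in auto)
  \<comment> \<open>The closing simplification rewrites only the non-strict thresholds, so the
    middle range is needed here with its strict bounds as quotients.\<close>
  have mid': "q = C3" if "1 - C2 / C3 < \<xi>" "\<xi> < C1 / C3"
    using that mid by (simp add: low_iff high_iff)
  have mid2: "C3 - (1 - \<xi>) * C3 = \<xi> * C3"
    by (simp add: algebra_simps)
  show ?thesis
    by (intro conjI impI; (elim conjE)?)
      (simp_all only: a b high low mid' mid2 high_iff(1) low_iff(1))
qed

end
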